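(* Let $st(5,1)=\limsup_{n\to\infty}\frac{\log_2 SM(n,5,1)}{n}$, where $SM(n,5,1)$ is the maximum cardinality of a locally $(5,1)$-thin family of subsets of $[n]$. Then $st(5,1)>0.1965$.
   Context: $[n]=\{1,2,\ldots,n\}$. A family $\mathcal{F}$ of subsets of $[n]$ is called locally $(k,b)$-thin if, for any $k$ distinct members of $\mathcal{F}$, there exist at least $b$ points of $[n]$ such that each of them is contained in exactly one of these $k$ members. (For $b=1$ this is the same as being $k$-locally thin.) $SM(n,k,b)$ denotes the maximum cardinality of a locally $(k,b)$-thin family of subsets of $[n]$. *)

theory Defs
  imports Complex_Main "HOL-Library.Extended_Real"
begin

definition locally_thin :: "nat \<Rightarrow> nat \<Rightarrow> nat \<Rightarrow> nat set set \<Rightarrow> bool" where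
  "locally_thin n k b F \<longleftrightarrow>
     F \<subseteq> Pow {1..n} \<and>
     (\<forall>G. G \<subseteq> F \<and> card G = k \<longrightarrow> b \<le> card {x \<in> {1..n}. \<exists>!A. A \<in> G \<and> x \<in> A})"

text \<open>For \<open>k \<ge> 1\<close> the empty family is locally thin, so this is the maximum of a finite nonempty set.\<close>
definition SM :: "nat \<Rightarrow> nat \<Rightarrow> nat \<Rightarrow> nat" where
  "SM n k b = Max {card F | F. locally_thin n k b F}"

text \<open>The limsup is taken in the extended reals, so that it exists without a boundedness argument.\<close>
definition st :: "nat \<Rightarrow> nat \<Rightarrow> ereal" where
  "st k b = limsup (\<lambda>n. ereal (log 2 (real (SM n k b)) / real n))"

end

theory Submission
  imports Defs "HOL-Library.FuncSet"
begin

text \<open>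
  Cut \<open>{1..5 * t}\<close> into \<open>t\<close> blocks of five points and use only sets that meet every block
  in one point, that is, words of length \<open>t\<close> over an alphabet of five letters. Five words
  form a \<^emph>\<open>clashing\<close> quintuple if in every position each letter that occurs does so at
  least twice. Because \<open>5\<close> splits into parts of size at least \<open>2\<close> only as \<open>5\<close> and \<open>2 + 3\<close>, a
  position admits just \<open>5 + 10 * 20 = 205\<close> of the \<open>5 ^ 5\<close> possible columns
  (\<open>card_clash_columns\<close>), so there are at most \<open>205 ^ t\<close> clashing sets of five words
  (\<open>card_clashing_sets\<close>).

  It remains to find many words without a clashing quintuple. This is an
  independent set in a \<open>5\<close>-uniform hypergraph on \<open>5 ^ t\<close> vertices. In a random
  colouring with \<open>q\<close> colours an edge is monochromatic with probability \<open>q\<close> to the power \<open>- 4\<close>, so if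
  \<open>2 * 205 ^ t \<le> q ^ 4 * 5 ^ t\<close>, then on average at most half as many edges as there
  are vertices survive, and deleting a vertex from each of them leaves a colour class with at least
  \<open>5 ^ t / (2 * q)\<close> vertices (\<open>uniform_hypergraph_independent_set\<close>). For \<open>t = 4 * s\<close> the choice
  \<open>q = 2 * 41 ^ s\<close> is possible and gives a family of size \<open>(625 / 41) ^ s / 4\<close> on \<open>20 * s\<close> points.
  Its rate tends to \<open>log 2 (625 / 41) / 20 = 0.196508...\<close>. Independent unstructured coordinates would
  only yield about \<open>0.1901\<close>; forcing one point per block is what gains the difference.
\<close>

section \<open>Independent sets in uniform hypergraphs\<close>

lemma exists_le_average:
  fixes f :: "'a \<Rightarrow> nat"
  assumes "finite A" "A \<noteq> {}" "(\<Sum>x\<in>A. f x) \<le> c * card A"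
  shows "\<exists>x\<in>A. f x \<le> c"
proof (rule ccontr)
  assume "\<not> ?thesis"
  then have "(\<Sum>x\<in>A. c) < (\<Sum>x\<in>A. f x)"
    using assms by (intro sum_strict_mono) auto
  with assms(3) show False by (simp add: mult.commute)
qed

lemma card_monochromatic_colourings:
  assumes "finite V" "e \<subseteq> V"
  shows "card {g \<in> V \<rightarrow>\<^sub>E {..<q}. \<exists>a<q. \<forall>v\<in>e. g v = a} \<le> q * q ^ (card V - card e)"
proof -
  let ?P = "\<lambda>a. PiE V (\<lambda>v. if v \<in> e then {a} else {..<q})"
  have fin: "finite (?P a)" for a
    using assms(1) by (intro finite_PiE) auto
  have card_P: "card (?P a) = q ^ (card V - card e)" for a
  proof -
    have "card (?P a) = (\<Prod>v\<in>V. if v \<in> e then 1 else q)"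
      using assms(1) by (simp add: card_PiE if_distrib cong: if_cong)
    also have "\<dots> = q ^ card (V - e)"
      using assms(1) by (simp add: prod.If_cases Diff_eq)
    also have "card (V - e) = card V - card e"
      using assms by (meson card_Diff_subset finite_subset)
    finally show ?thesis .
  qed
  have "{g \<in> V \<rightarrow>\<^sub>E {..<q}. \<exists>a<q. \<forall>v\<in>e. g v = a} \<subseteq> (\<Union>a<q. ?P a)"
    by (fastforce simp: PiE_iff)
  then have "card {g \<in> V \<rightarrow>\<^sub>E {..<q}. \<exists>a<q. \<forall>v\<in>e. g v = a} \<le> card (\<Union>a<q. ?P a)"
    by (rule card_mono[rotated]) (use fin in auto)
  also have "\<dots> \<le> (\<Sum>a<q. card (?P a))"
    by (rule card_UN_le) simp
  also have "\<dots> = q * q ^ (card V - card e)"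
    by (simp add: card_P)
  finally show ?thesis .
qed

text \<open>
  Colouring the vertices and working inside a colour class replaces the usual random vertex subset:
  the classes are automatically sets of vertices, and the average is a plain count of functions.
\<close>

lemma uniform_hypergraph_independent_set:
  fixes V :: "'a set"
  assumes V: "finite V"
    and E: "\<And>e. e \<in> E \<Longrightarrow> e \<subseteq> V \<and> card e = Suc r"
    and q: "q > 0"
    and few: "2 * card E \<le> q ^ r * card V"
  shows "\<exists>W\<subseteq>V. (\<forall>e\<in>E. \<not> e \<subseteq> W) \<and> card V \<le> 2 * q * card W"
proof -
  let ?C = "V \<rightarrow>\<^sub>E {..<q}"
  define mono_edges where "mono_edges g a = {e \<in> E. \<forall>v\<in>e. g v = a}" for g :: "'a \<Rightarrow> nat" and a
  have finE: "finite E"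
    using V E by (meson Pow_iff finite_Pow_iff finite_subset subsetI)
  have finC: "finite ?C" and C_ne: "?C \<noteq> {}"
    using V q by (auto intro!: finite_PiE simp: PiE_eq_empty_iff)
  have card_C: "card ?C = q ^ card V"
    using V by (simp add: card_PiE)
  have fin_mono: "finite (mono_edges g a)" for g a
    using finE by (simp add: mono_edges_def)
  define mono where "mono g = {e \<in> E. \<exists>a<q. \<forall>v\<in>e. g v = a}" for g :: "'a \<Rightarrow> nat"
  have "(\<Sum>g\<in>?C. q ^ r * card (mono g)) = q ^ r * (\<Sum>g\<in>?C. \<Sum>e\<in>E. of_bool (\<exists>a<q. \<forall>v\<in>e. g v = a))"
    using finE by (simp add: mono_def sum_distrib_left Int_def)
  also have "\<dots> = q ^ r * (\<Sum>e\<in>E. card {g \<in> ?C. \<exists>a<q. \<forall>v\<in>e. g v = a})"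
    by (subst sum.swap) (use finC in \<open>simp add: Int_def\<close>)
  also have "\<dots> \<le> q ^ r * (\<Sum>e\<in>E. q * q ^ (card V - Suc r))"
  proof (intro mult_left_mono sum_mono)
    fix e assume "e \<in> E"
    then show "card {g \<in> ?C. \<exists>a<q. \<forall>v\<in>e. g v = a} \<le> q * q ^ (card V - Suc r)"
      using E[of e] card_monochromatic_colourings[OF V, of e q] by simp
  qed simp
  also have "\<dots> = (\<Sum>e\<in>E. q ^ (Suc r + (card V - Suc r)))"
    by (simp add: power_add mult_ac)
  also have "\<dots> = (\<Sum>e\<in>E. q ^ card V)"
  proof (rule sum.cong)
    fix e assume "e \<in> E"
    then have "Suc r \<le> card V"
      using E[of e] V card_mono by metis
    then show "q ^ (Suc r + (card V - Suc r)) = q ^ card V" by simp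
  qed simp
  finally have "(\<Sum>g\<in>?C. q ^ r * card (mono g)) \<le> card E * card ?C"
    by (simp add: card_C)
  from exists_le_average[OF finC C_ne this]
  obtain g where g: "g \<in> ?C" and "q ^ r * card (mono g) \<le> card E"
    by auto
  then have "q ^ r * (2 * card (mono g)) \<le> q ^ r * card V"
    using few by linarith
  then have mono_le: "2 * card (mono g) \<le> card V"
    using q by simp
  let ?V = "\<lambda>a. {v \<in> V. g v = a}"
  have mono_eq: "mono g = (\<Union>a<q. mono_edges g a)"
    by (auto simp: mono_def mono_edges_def)
  have "card (mono g) = (\<Sum>a<q. card (mono_edges g a))"
    unfolding mono_eq
  proof (rule card_UN_disjoint)
    show "\<forall>a\<in>{..<q}. \<forall>b\<in>{..<q}. a \<noteq> b \<longrightarrow> mono_edges g a \<inter> mono_edges g b = {}"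
    proof (intro ballI impI equals0I)
      fix a b e assume "a \<noteq> b" and e: "e \<in> mono_edges g a \<inter> mono_edges g b"
      then have "e \<noteq> {}"
        using E[of e] by (auto simp: mono_edges_def)
      then show False
        using e \<open>a \<noteq> b\<close> by (auto simp: mono_edges_def)
    qed
  qed (use fin_mono in auto)
  moreover have "card V = (\<Sum>a<q. card (?V a))"
  proof -
    have "V = (\<Union>a<q. ?V a)" using g by (auto simp: PiE_iff)
    then have "card V = card (\<Union>a<q. ?V a)" by simp
    also have "\<dots> = (\<Sum>a<q. card (?V a))"
      by (rule card_UN_disjoint) (use V in auto)
    finally show ?thesis .
  qed
  ultimately have "int (card (mono g)) = (\<Sum>a<q. int (card (mono_edges g a)))"
    and "int (card V) = (\<Sum>a<q. int (card (?V a)))"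
    by simp_all
  then have total: "int (card V) \<le> (\<Sum>a<q. 2 * (int (card (?V a)) - int (card (mono_edges g a))))"
    using mono_le by (simp add: sum_subtractf flip: sum_distrib_left)
  \<comment> \<open>Some colour class exceeds its number of monochromatic edges by at least the average over
    the colours; the differences may be negative, hence integers.\<close>
  have "\<exists>a<q. int (card V) \<le> 2 * int q * (int (card (?V a)) - int (card (mono_edges g a)))"
  proof (rule ccontr)
    let ?d = "\<lambda>a. 2 * (int (card (?V a)) - int (card (mono_edges g a)))"
    assume "\<not> ?thesis"
    then have "\<And>a. a < q \<Longrightarrow> int q * ?d a < int (card V)"
      by (auto simp: algebra_simps)
    then have "(\<Sum>a<q. int q * ?d a) < (\<Sum>a<q. int (card V))"
      using q by (intro sum_strict_mono) auto
    then have "int q * (\<Sum>a<q. ?d a) < int q * int (card V)"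
      by (simp add: sum_distrib_left)
    with total show False
      using q by simp
  qed
  then obtain a where a: "int (card V) \<le> 2 * int q * (int (card (?V a)) - int (card (mono_edges g a)))"
    by blast
  define pick where "pick e = (SOME v. v \<in> e)" for e :: "'a set"
  have pick: "pick e \<in> e" if "e \<in> E" for e
    using E[OF that] unfolding pick_def by (metis card.empty nat.distinct(1) some_in_eq)
  define W where "W = ?V a - pick ` mono_edges g a"
  have "card (?V a) \<le> card W + card (mono_edges g a)"
  proof -
    have "card (?V a) - card (pick ` mono_edges g a) \<le> card W"
      unfolding W_def by (rule diff_card_le_card_Diff) (simp add: fin_mono)
    with card_image_le[OF fin_mono, of pick g a] show ?thesis by linarith
  qed
  then have "2 * int q * (int (card (?V a)) - int (card (mono_edges g a))) \<le> 2 * int q * int (card W)"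
    by (intro mult_left_mono) auto
  with a have "int (card V) \<le> int (2 * q * card W)"
    by simp
  then have "card V \<le> 2 * q * card W"
    by (simp only: of_nat_le_iff)
  moreover have "\<not> e \<subseteq> W" if "e \<in> E" for e
  proof
    assume sub: "e \<subseteq> W"
    then have "e \<in> mono_edges g a"
      using that by (auto simp: W_def mono_edges_def)
    then show False
      using pick[OF that] sub by (auto simp: W_def)
  qed
  moreover have "W \<subseteq> V" by (auto simp: W_def)
  ultimately show ?thesis by blast
qed

section \<open>Clashing quintuples of words\<close>

definition clash_columns :: "(nat \<Rightarrow> nat) set" where
  "clash_columns = {c \<in> {..<5} \<rightarrow>\<^sub>E {..<5}. \<forall>a. \<not> (\<exists>!j. j < 5 \<and> c j = a)}"

definition words :: "nat \<Rightarrow> (nat \<Rightarrow> nat) set" where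
  "words t = {..<t} \<rightarrow>\<^sub>E {..<5}"

definition clashing_sets :: "nat \<Rightarrow> (nat \<Rightarrow> nat) set set" where
  "clashing_sets t =
     {G. G \<subseteq> words t \<and> card G = 5 \<and> (\<forall>i<t. \<forall>a. \<not> (\<exists>!w. w \<in> G \<and> w i = a))}"

lemma finite_clash_columns: "finite clash_columns"
  unfolding clash_columns_def by (rule finite_subset[of _ "{..<5} \<rightarrow>\<^sub>E {..<5}"]) (auto intro: finite_PiE)

lemma card_ge_2_if_not_unique:
  assumes "finite S" "x \<in> S" "\<not> (\<exists>!y. y \<in> S)"
  shows "2 \<le> card S"
proof -
  obtain y where "y \<in> S" "y \<noteq> x" using assms by blast
  then have "card {x, y} \<le> card S" using assms by (intro card_mono) auto
  with \<open>y \<noteq> x\<close> show ?thesis by simp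
qed

text \<open>
  A non-constant column has two letters with at least two occurrences each, which leaves at most one
  place, too few for a third letter. One of the two letters occurs exactly twice.
\<close>

lemma clash_column_cases:
  assumes "c \<in> clash_columns"
  obtains a where "a < 5" "c = (\<lambda>j\<in>{..<5}. a)"
  | P a b where "P \<subseteq> {..<5}" "card P = 2" "a < 5" "b < 5" "a \<noteq> b"
      "c = (\<lambda>j\<in>{..<5}. if j \<in> P then a else b)"
proof -
  let ?F = "\<lambda>a. {j. j < 5 \<and> c j = a}"
  have c: "c \<in> {..<5} \<rightarrow>\<^sub>E {..<5}" and nu: "\<And>a. \<not> (\<exists>!j. j < 5 \<and> c j = a)"
    using assms by (auto simp: clash_columns_def)
  have range: "c j < 5" if "j < 5" for j
    using c that by (auto simp: PiE_iff)
  have fibre: "2 \<le> card (?F (c j))" if "j < 5" for j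
    using nu[of "c j"] that by (intro card_ge_2_if_not_unique[of _ j]) auto
  show thesis
  proof (cases "\<forall>j<5. c j = c 0")
    case True
    have "c j = (\<lambda>j\<in>{..<5}. c 0) j" for j
    proof (cases "j < 5")
      case True
      then show ?thesis using \<open>\<forall>j<5. c j = c 0\<close>[rule_format, of j] by simp
    next
      case False
      then show ?thesis using c by (simp add: PiE_iff extensional_def)
    qed
    then have "c = (\<lambda>j\<in>{..<5}. c 0)" by (rule ext)
    then show ?thesis using that(1)[of "c 0"] range[of 0] by simp
  next
    case False
    then obtain k where k: "k < 5" "c k \<noteq> c 0" by blast
    let ?A = "?F (c 0)" and ?B = "?F (c k)"
    have cardAB: "card (?A \<union> ?B) = card ?A + card ?B"
      using k by (intro card_Un_disjoint) auto
    have two: "c j = c 0 \<or> c j = c k" if j: "j < 5" for j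
    proof (rule ccontr)
      assume *: "\<not> ?thesis"
      have "card ((?A \<union> ?B) \<union> ?F (c j)) = card (?A \<union> ?B) + card (?F (c j))"
        using * by (intro card_Un_disjoint) auto
      moreover have "card ((?A \<union> ?B) \<union> ?F (c j)) \<le> card {..<5::nat}"
        by (intro card_mono) auto
      ultimately show False
        using cardAB fibre[of 0] fibre[OF k(1)] fibre[OF j] by simp
    qed
    then have "?A \<union> ?B = {..<5}" using k by auto
    then have "card ?A + card ?B = 5" using cardAB by simp
    then consider "card ?A = 2" | "card ?B = 2"
      using fibre[of 0] fibre[OF k(1)] by force
    then show ?thesis
    proof cases
      case 1
      have "c = (\<lambda>j\<in>{..<5}. if j \<in> ?A then c 0 else c k)"
        using c two by (intro ext) (auto simp: PiE_iff extensional_def)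
      then show ?thesis
        using that(2)[of ?A "c 0" "c k"] 1 range[of 0] range[OF k(1)] k by force
    next
      case 2
      have "c = (\<lambda>j\<in>{..<5}. if j \<in> ?B then c k else c 0)"
        using c two by (intro ext) (auto simp: PiE_iff extensional_def)
      then show ?thesis
        using that(2)[of ?B "c k" "c 0"] 2 range[of 0] range[OF k(1)] k by force
    qed
  qed
qed

lemma card_clash_columns: "card clash_columns \<le> 205"
proof -
  let ?Pairs = "{P. P \<subseteq> {..<5::nat} \<and> card P = 2}"
  let ?Letters = "(SIGMA a:{..<5::nat}. {..<5} - {a})"
  let ?const = "\<lambda>a::nat. \<lambda>j\<in>{..<5::nat}. a"
  let ?two = "\<lambda>(P, a, b). \<lambda>j\<in>{..<5::nat}. if j \<in> P then a else (b::nat)"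
  have "clash_columns \<subseteq> ?const ` {..<5} \<union> ?two ` (?Pairs \<times> ?Letters)"
  proof
    fix c assume "c \<in> clash_columns"
    then show "c \<in> ?const ` {..<5} \<union> ?two ` (?Pairs \<times> ?Letters)"
    proof (cases rule: clash_column_cases)
      case (1 a)
      then show ?thesis by blast
    next
      case (2 P a b)
      then have "c = ?two (P, a, b)" "(P, a, b) \<in> ?Pairs \<times> ?Letters" by auto
      then show ?thesis by blast
    qed
  qed
  then have "card clash_columns \<le> card (?const ` {..<5} \<union> ?two ` (?Pairs \<times> ?Letters))"
    by (rule card_mono[rotated]) auto
  also have "\<dots> \<le> card (?const ` {..<5}) + card (?two ` (?Pairs \<times> ?Letters))"
    by (rule card_Un_le)
  also have "\<dots> \<le> card {..<5::nat} + card (?Pairs \<times> ?Letters)"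
    by (intro add_mono card_image_le) auto
  also have "card (?Pairs \<times> ?Letters) = 10 * 20"
  proof -
    have "card ?Pairs = 10"
      using n_subsets[of "{..<5::nat}" 2] by (simp add: choose_two)
    moreover have "card ?Letters = 20"
      by (subst card_SigmaI) auto
    ultimately show ?thesis by (simp only: card_cartesian_product)
  qed
  finally show ?thesis by simp
qed

text \<open>
  Enumerating a clashing set as five rows of a table turns it into \<open>t\<close> independent choices of a
  column from \<open>clash_columns\<close>.
\<close>

lemma card_clashing_sets: "card (clashing_sets t) \<le> 205 ^ t"
proof -
  let ?rows = "\<lambda>c. (\<lambda>j. \<lambda>i\<in>{..<t}. c i j) ` {..<5::nat}"
  let ?T = "{..<t} \<rightarrow>\<^sub>E clash_columns"
  have finT: "finite ?T" by (intro finite_PiE) (auto simp: finite_clash_columns)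
  have "clashing_sets t \<subseteq> ?rows ` ?T"
  proof
    fix G assume G: "G \<in> clashing_sets t"
    then have "card G = 5" by (simp add: clashing_sets_def)
    moreover from this have "finite G" by (intro card_ge_0_finite) simp
    ultimately obtain h where "bij_betw h {..<5::nat} G"
      by (metis ex_bij_betw_nat_finite atLeast0LessThan)
    then have img: "h ` {..<5} = G"
      by (simp add: bij_betw_def)
    have word: "h j \<in> words t" if "j < 5" for j
      using G img that by (auto simp: clashing_sets_def)
    define c where "c = (\<lambda>i\<in>{..<t}. \<lambda>j\<in>{..<5::nat}. h j i)"
    have "c i \<in> clash_columns" if i: "i < t" for i
    proof -
      have "\<not> (\<exists>!j. j < 5 \<and> h j i = a)" for a
      proof
        assume "\<exists>!j. j < 5 \<and> h j i = a"
        then obtain j where j: "j < 5" "h j i = a" and u: "\<And>l. l < 5 \<Longrightarrow> h l i = a \<Longrightarrow> l = j"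
          by auto
        have "\<exists>!w. w \<in> G \<and> w i = a"
        proof (rule ex1I[of _ "h j"])
          show "h j \<in> G \<and> h j i = a" using j img by auto
        next
          fix w assume "w \<in> G \<and> w i = a"
          then obtain l where "l < 5" "w = h l" using img by auto
          then show "w = h j" using u \<open>w \<in> G \<and> w i = a\<close> by auto
        qed
        then show False using G i by (auto simp: clashing_sets_def)
      qed
      then have "\<not> (\<exists>!j. j < 5 \<and> c i j = a)" for a
        using i by (simp add: c_def cong: conj_cong)
      moreover have "c i \<in> {..<5} \<rightarrow>\<^sub>E {..<5}"
        using i word by (auto simp: c_def words_def PiE_iff)
      ultimately show ?thesis by (simp add: clash_columns_def)
    qed
    then have "c \<in> ?T" by (auto simp: c_def)
    moreover have "G = ?rows c"
    proof -
      have "(\<lambda>i\<in>{..<t}. c i j) = h j" if "j < 5" for j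
        using word[OF that] that
        by (intro ext) (auto simp: c_def words_def PiE_iff extensional_def)
      then have "?rows c = h ` {..<5}" by (intro image_cong) auto
      then show ?thesis using img by simp
    qed
    ultimately show "G \<in> ?rows ` ?T" by blast
  qed
  then have "card (clashing_sets t) \<le> card (?rows ` ?T)"
    by (rule card_mono[rotated]) (use finT in simp)
  also have "\<dots> \<le> card ?T" by (rule card_image_le[OF finT])
  also have "\<dots> = card clash_columns ^ t" by (simp add: card_PiE)
  also have "\<dots> \<le> 205 ^ t" by (rule power_mono[OF card_clash_columns]) simp
  finally show ?thesis .
qed

section \<open>From words to locally thin families\<close>

definition block_set :: "nat \<Rightarrow> (nat \<Rightarrow> nat) \<Rightarrow> nat set" where
  "block_set t w = (\<lambda>i. 5 * i + w i + 1) ` {..<t}"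

lemma mem_block_set_iff:
  assumes "w \<in> words t" "i < t" "a < 5"
  shows "5 * i + a + 1 \<in> block_set t w \<longleftrightarrow> w i = a"
proof
  assume "5 * i + a + 1 \<in> block_set t w"
  then obtain l where l: "l < t" "5 * i + a = 5 * l + w l" by (auto simp: block_set_def)
  have "w l < 5" using assms(1) l(1) by (auto simp: words_def)
  then show "w i = a" using l(2) assms(3) by (cases "i = l") presburger+
next
  assume "w i = a"
  then show "5 * i + a + 1 \<in> block_set t w"
    unfolding block_set_def using assms(2) by (intro image_eqI[of _ _ i]) simp_all
qed

lemma block_set_subset:
  assumes "w \<in> words t"
  shows "block_set t w \<subseteq> {1..5 * t}"
proof -
  have "5 * i + w i + 1 \<le> 5 * t" if "i < t" for i
  proof -
    have "w i < 5" using assms that by (auto simp: words_def)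
    then show ?thesis using that by linarith
  qed
  then show ?thesis by (auto simp: block_set_def)
qed

lemma inj_on_block_set: "inj_on (block_set t) (words t)"
proof
  fix v w assume v: "v \<in> words t" and w: "w \<in> words t" and eq: "block_set t v = block_set t w"
  show "v = w"
  proof (rule PiE_ext)
    show "v \<in> {..<t} \<rightarrow>\<^sub>E {..<5}" "w \<in> {..<t} \<rightarrow>\<^sub>E {..<5}"
      using v w by (auto simp: words_def)
    fix i assume i: "i \<in> {..<t}"
    then have "w i < 5" using w by (auto simp: words_def)
    then show "v i = w i"
      using mem_block_set_iff[OF v, of i "w i"] mem_block_set_iff[OF w, of i "w i"] i eq by simp
  qed
qed

lemma locally_thin_block_sets:
  assumes W: "W \<subseteq> words t" and free: "\<forall>e\<in>clashing_sets t. \<not> e \<subseteq> W"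
  shows "locally_thin (5 * t) 5 1 (block_set t ` W)"
  unfolding locally_thin_def
proof (intro conjI allI impI)
  show "block_set t ` W \<subseteq> Pow {1..5 * t}"
    using W block_set_subset by blast
next
  fix G assume "G \<subseteq> block_set t ` W \<and> card G = 5"
  then obtain H where H: "H \<subseteq> W" "G = block_set t ` H" and "card G = 5"
    by (meson subset_imageE)
  moreover have "inj_on (block_set t) H"
    using inj_on_block_set H W by (meson inj_on_subset)
  ultimately have "card H = 5" by (simp add: card_image)
  moreover have "H \<subseteq> words t" "H \<notin> clashing_sets t"
    using free H W by blast+
  ultimately have "\<not> (\<forall>i<t. \<forall>a. \<not> (\<exists>!w. w \<in> H \<and> w i = a))"
    unfolding clashing_sets_def by blast
  then obtain i a w where i: "i < t" and w: "w \<in> H" "w i = a"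
    and u: "\<And>v. v \<in> H \<Longrightarrow> v i = a \<Longrightarrow> v = w" by blast
  have a: "a < 5" using w i H W by (auto simp: words_def)
  let ?x = "5 * i + a + 1"
  have mem: "?x \<in> block_set t v \<longleftrightarrow> v i = a" if "v \<in> H" for v
    using mem_block_set_iff[OF _ i a] that H W by auto
  have "\<exists>!A. A \<in> G \<and> ?x \<in> A"
  proof (rule ex1I[of _ "block_set t w"])
    show "block_set t w \<in> G \<and> ?x \<in> block_set t w"
      using H(2) w mem by blast
  next
    fix A assume A: "A \<in> G \<and> ?x \<in> A"
    then obtain v where v: "v \<in> H" "A = block_set t v" using H(2) by blast
    with A have "v = w" using mem u by blast
    with v show "A = block_set t w" by simp
  qed
  moreover have "?x \<in> {1..5 * t}" using i a by auto
  ultimately have "{?x} \<subseteq> {x \<in> {1..5 * t}. \<exists>!A. A \<in> G \<and> x \<in> A}" by blast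
  from card_mono[OF _ this]
  show "1 \<le> card {x \<in> {1..5 * t}. \<exists>!A. A \<in> G \<and> x \<in> A}" by simp
qed

lemma card_le_SM:
  assumes "locally_thin n k b F"
  shows "card F \<le> SM n k b"
  unfolding SM_def
proof (rule Max_ge)
  have "{card F |F. locally_thin n k b F} \<subseteq> card ` Pow (Pow {1..n})"
    by (auto simp: locally_thin_def)
  then show "finite {card F |F. locally_thin n k b F}"
    by (rule finite_subset) simp
qed (use assms in blast)

text \<open>
  The length \<open>4 * s\<close> makes the fourth root of \<open>41 ^ t\<close> an integer, which is the only reason to leave
  out the other lengths; a subsequence suffices for the upper limit.
\<close>

lemma SM_lower_bound: "625 ^ s \<le> 4 * 41 ^ s * SM (20 * s) 5 1"
proof -
  let ?t = "4 * s" and ?q = "2 * 41 ^ s :: nat"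
  have card_words: "card (words ?t) = 5 ^ ?t"
    by (simp add: words_def card_PiE)
  have "2 * card (clashing_sets ?t) \<le> 2 * 205 ^ ?t"
    using card_clashing_sets[of ?t] by simp
  also have "\<dots> = 2 * 41 ^ ?t * 5 ^ ?t"
    by (simp flip: power_mult_distrib)
  also have "\<dots> \<le> ?q ^ 4 * 5 ^ ?t"
    by (simp add: power_mult_distrib mult.commute flip: power_mult)
  finally have few: "2 * card (clashing_sets ?t) \<le> ?q ^ 4 * card (words ?t)"
    by (simp add: card_words)
  have "finite (words ?t)" by (auto simp: words_def intro: finite_PiE)
  then obtain W where W: "W \<subseteq> words ?t" "\<forall>e\<in>clashing_sets ?t. \<not> e \<subseteq> W"
    and card_W: "card (words ?t) \<le> 2 * ?q * card W"
    using uniform_hypergraph_independent_set[OF _ _ _ few] by (auto simp: clashing_sets_def)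
  have "card W = card (block_set ?t ` W)"
    using inj_on_block_set W(1) by (metis card_image inj_on_subset)
  also have "\<dots> \<le> SM (20 * s) 5 1"
    using card_le_SM[OF locally_thin_block_sets[OF W]] by simp
  finally have "2 * ?q * card W \<le> 2 * ?q * SM (20 * s) 5 1" by (rule mult_left_mono) simp
  with card_W have "5 ^ ?t \<le> 2 * ?q * SM (20 * s) 5 1"
    by (simp only: card_words)
  then show ?thesis
    by (simp add: power_mult)
qed

section \<open>The rate\<close>

text \<open>
  Since \<open>20 * 0.1965 = 393 / 100\<close>, raising to the hundredth power reduces the claim to an inequality
  between integers.
\<close>

lemma rate_numeric: "0.1965 < log 2 (625 / 41) / 20"
proof -
  have "(2::real) ^ 393 < (625 / 41) ^ 100"
    by (simp add: power_divide)
  then have "log 2 (2 ^ 393) < log 2 ((625 / 41 :: real) ^ 100)"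
    by (subst log_less_cancel_iff) simp_all
  then have "393 < 100 * log 2 (625 / 41 :: real)"
    by (simp only: log_nat_power) (simp add: log_nat_power)
  then show ?thesis by simp
qed

theorem mainTheorem4:
  shows "st 5 1 > ereal 0.1965"
proof -
  let ?L = "log 2 (625 / 41 :: real)"
  let ?f = "\<lambda>n. ereal (log 2 (real (SM n 5 1)) / real n)"
  let ?g = "\<lambda>s. ?L / 20 - (1 / 10) * inverse (real s)"
  have bound: "?g s \<le> log 2 (real (SM (20 * s) 5 1)) / real (20 * s)" if "s > 0" for s
  proof -
    let ?M = "real (SM (20 * s) 5 1)"
    have "real (625 ^ s) \<le> real (4 * 41 ^ s * SM (20 * s) 5 1)"
      using SM_lower_bound[of s] by (simp only: of_nat_le_iff)
    then have le: "(625 / 41) ^ s / 4 \<le> ?M"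
      by (simp add: power_divide divide_simps mult_ac)
    have "real s * ?L - 2 = log 2 ((625 / 41) ^ s / 4)"
    proof -
      have "log 2 4 = (2::real)" using log_pow_cancel[of 2 2] by simp
      then show ?thesis by (simp add: log_divide_pos log_nat_power)
    qed
    also have "\<dots> \<le> log 2 ?M"
    proof (rule log_mono[OF _ _ le])
      show "0 < (625 / 41 :: real) ^ s / 4" by simp
    qed simp
    finally have "(real s * ?L - 2) / real (20 * s) \<le> log 2 ?M / real (20 * s)"
      by (rule divide_right_mono) simp
    moreover have "(real s * ?L - 2) / real (20 * s) = ?g s"
      using that by (simp add: field_simps)
    ultimately show ?thesis by simp
  qed
  have "(\<lambda>s. ?L / 20 - (1 / 10) * inverse (real s)) \<longlonglongrightarrow> ?L / 20 - (1 / 10) * 0"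
    by (intro tendsto_intros lim_inverse_n)
  then have "(\<lambda>s. ereal (?g s)) \<longlonglongrightarrow> ereal (?L / 20)"
    by simp
  then have "ereal (?L / 20) = limsup (\<lambda>s. ereal (?g s))"
    by (rule lim_imp_Limsup[OF sequentially_bot, symmetric])
  also have "\<dots> \<le> limsup (?f \<circ> (\<lambda>s. 20 * s))"
    by (rule Limsup_mono, rule eventually_mono[OF eventually_gt_at_top[of 0]]) (use bound in simp)
  also have "\<dots> \<le> limsup ?f"
    by (rule limsup_subseq_mono) (simp add: strict_mono_def)
  finally have "ereal (?L / 20) \<le> st 5 1" by (simp add: st_def)
  moreover have "ereal 0.1965 < ereal (?L / 20)"
    using rate_numeric by simp
  ultimately show ?thesis by (rule less_le_trans[rotated])
qed

end
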